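(* Let $\Delta$ be a balanced simplicial complex of type $\mathbf{a}=(a_1,\dots,a_m)\in\mathbb{N}^m$. For every $\mathbf{b}\in\mathbb{N}^m$ with $\mathbf{b}\le\mathbf{a}$, $$h_{\mathbf{b}}-h_{\mathbf{a}-\mathbf{b}}=(-1)^{|\mathbf{a}|-|\mathbf{b}|}\sum_{F\in\Delta_{\mathbf{b}}}\binom{\mathbf{a}-\mathbf{b}(F)}{\mathbf{a}-\mathbf{b}}\,\epsilon_F,$$ where $\Delta_{\mathbf{b}}:=\{F\in\Delta:\mathbf{b}(F)\le\mathbf{b}\}$ is the set of faces with at most $b_i$ vertices of color $i$ for all $i$.
   Context: Here $\mathbb{N}=\{0,1,2,\dots\}$ and $m$ is a positive integer. For $\mathbf{b},\mathbf{c}\in\mathbb{N}^m$: $|\mathbf{b}|=b_1+\dots+b_m$, $\mathbf{b}\le\mathbf{c}$ is meant componentwise, and $\binom{\mathbf{b}}{\mathbf{c}}=\prod_{i=1}^m\binom{b_i}{c_i}$. A simplicial complex is a finite collection of finite sets (faces), containing the empty face, closed under taking subsets; its dimension is the maximum of $|F|-1$ over faces $F$. A simplicial complex $\Delta$ of dimension $d-1$ with vertex set $V$ is balanced of type $\mathbf{a}$ if it is equipped with a vertex coloring $\kappa:V\to\{1,\dots,m\}$ such that every maximal face contains exactly $a_i$ vertices of color $i$ for each $i$; hence $d=|\mathbf{a}|$. For $F\in\Delta$, $\mathbf{b}(F)\in\mathbb{N}^m$ is the vector whose $i$-th entry is the number of vertices of $F$ with color $i$. For $\mathbf{b}\le\mathbf{a}$,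 $f_{\mathbf{b}}$ is the number of faces $F$ with $\mathbf{b}(F)=\mathbf{b}$. For $\mathbf{x}=(x_1,\dots,x_m)$ write $\mathbf{x}^{\mathbf{b}}=\prod_i x_i^{b_i}$ and $(\mathbf{1}-\mathbf{x})^{\mathbf{b}}=\prod_i(1-x_i)^{b_i}$. The flag $h$-numbers $h_{\mathbf{b}}$ ($\mathbf{b}\le\mathbf{a}$) are defined by $\sum_{\mathbf{b}\le\mathbf{a}}h_{\mathbf{b}}\mathbf{x}^{\mathbf{b}}=\sum_{F\in\Delta}\mathbf{x}^{\mathbf{b}(F)}(\mathbf{1}-\mathbf{x})^{\mathbf{a}-\mathbf{b}(F)}$. The link of $F$ is $\mathrm{lk}_\Delta F=\{G\in\Delta:G\cap F=\emptyset,\ G\cup F\in\Delta\}$, the reduced Euler characteristic of a finite complex $\Gamma$ is $\widetilde\chi(\Gamma)=\sum_{G\in\Gamma}(-1)^{|G|-1}$ (including the empty face), and the error of a face $F\in\Delta$ is $\epsilon_F=\widetilde\chi(\mathrm{lk}_\Delta F)-(-1)^{d-1-|F|}$. *)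

theory Defs
  imports "HOL-Analysis.Finite_Cartesian_Product" "HOL-Library.Poly_Mapping"
begin

text \<open>
  The colors \<open>1, \<dots>, m\<close> are the elements of an arbitrary finite type \<open>'m\<close>, so
  \<open>m = CARD('m) \<ge> 1\<close>, and a vector of natural numbers indexed by the colors is an element of
  \<open>nat ^ 'm\<close>, on which \<open>\<le>\<close>, \<open>+\<close> and \<open>-\<close> are componentwise. The subtraction truncates;
  it is only applied to \<open>c\<close> and \<open>b\<close> with \<open>b \<le> c\<close>.
\<close>

definition vsize :: "nat ^ 'm \<Rightarrow> nat" where
  "vsize b = (\<Sum>i\<in>UNIV. b $ i)"

definition vbinom :: "nat ^ 'm \<Rightarrow> nat ^ 'm \<Rightarrow> nat" where
  "vbinom b c = (\<Prod>i\<in>UNIV. (b $ i) choose (c $ i))"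

definition simplicial_complex :: "'v set set \<Rightarrow> bool" where
  "simplicial_complex \<Delta> \<longleftrightarrow>
     finite \<Delta> \<and> (\<forall>F\<in>\<Delta>. finite F) \<and> {} \<in> \<Delta> \<and> (\<forall>F\<in>\<Delta>. \<forall>G. G \<subseteq> F \<longrightarrow> G \<in> \<Delta>)"

definition complex_dim :: "'v set set \<Rightarrow> int" where
  "complex_dim \<Delta> = Max ((\<lambda>F. int (card F) - 1) ` \<Delta>)"

definition maximal_face :: "'v set set \<Rightarrow> 'v set \<Rightarrow> bool" where
  "maximal_face \<Delta> F \<longleftrightarrow> F \<in> \<Delta> \<and> (\<forall>G\<in>\<Delta>. F \<subseteq> G \<longrightarrow> G = F)"

definition color_vec :: "('v \<Rightarrow> 'm) \<Rightarrow> 'v set \<Rightarrow> nat ^ 'm" where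
  "color_vec \<kappa> F = (\<chi> i. card {v \<in> F. \<kappa> v = i})"

text \<open>The coloring is a total function; only its values on vertices of \<open>\<Delta>\<close> matter.\<close>

definition balanced :: "'v set set \<Rightarrow> ('v \<Rightarrow> 'm) \<Rightarrow> nat ^ 'm \<Rightarrow> bool" where
  "balanced \<Delta> \<kappa> a \<longleftrightarrow>
     simplicial_complex \<Delta> \<and>
     (\<forall>F. maximal_face \<Delta> F \<longrightarrow> (\<forall>i. card {v \<in> F. \<kappa> v = i} = a $ i))"

text \<open>
  Integer polynomials in variables indexed by \<open>'m\<close> are the finitely supported functions from
  exponent vectors to coefficients, with the convolution product of \<open>Poly_Mapping\<close>.
\<close>

type_synonym 'm mpoly_int = "(nat ^ 'm) \<Rightarrow>\<^sub>0 int"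

definition X :: "'m::finite \<Rightarrow> 'm mpoly_int" where
  "X i = Poly_Mapping.single (axis i 1) 1"

definition flag_h_poly :: "'v set set \<Rightarrow> ('v \<Rightarrow> 'm::finite) \<Rightarrow> nat ^ 'm \<Rightarrow> 'm mpoly_int" where
  "flag_h_poly \<Delta> \<kappa> a =
     (\<Sum>F\<in>\<Delta>. (\<Prod>i\<in>UNIV. X i ^ (color_vec \<kappa> F $ i)) *
              (\<Prod>i\<in>UNIV. (1 - X i) ^ ((a - color_vec \<kappa> F) $ i)))"

text \<open>
  The flag \<open>h\<close>-number is a coefficient of this polynomial; the defining polynomial identity
  is the lemma \<open>flag_h_identity\<close> below.
\<close>

definition flag_h :: "'v set set \<Rightarrow> ('v \<Rightarrow> 'm::finite) \<Rightarrow> nat ^ 'm \<Rightarrow> nat ^ 'm \<Rightarrow> int" where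
  "flag_h \<Delta> \<kappa> a b = Poly_Mapping.lookup (flag_h_poly \<Delta> \<kappa> a) b"

definition link :: "'v set set \<Rightarrow> 'v set \<Rightarrow> 'v set set" where
  "link \<Delta> F = {G \<in> \<Delta>. G \<inter> F = {} \<and> G \<union> F \<in> \<Delta>}"

text \<open>
  The power \<open>(-1)\<^sup>k\<close> for an integer \<open>k\<close>, which may be negative: the empty face
  contributes \<open>(-1)\<close> to the power \<open>-1\<close> to the reduced Euler characteristic.
\<close>

definition neg_one_power :: "int \<Rightarrow> int" where
  "neg_one_power k = (if even k then 1 else -1)"

lemma of_int_neg_one_power: "(of_int (neg_one_power k) :: 'a::field) = (-1) powi k"
  by (auto simp: neg_one_power_def power_int_minus_left)

definition reduced_euler :: "'v set set \<Rightarrow> int" where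
  "reduced_euler \<Gamma> = (\<Sum>G\<in>\<Gamma>. neg_one_power (int (card G) - 1))"

text \<open>\<open>complex_dim \<Delta>\<close> is \<open>d - 1\<close>.\<close>

definition face_error :: "'v set set \<Rightarrow> 'v set \<Rightarrow> int" where
  "face_error \<Delta> F = reduced_euler (link \<Delta> F) - neg_one_power (complex_dim \<Delta> - int (card F))"

lemma color_vec_le:
  assumes "balanced \<Delta> \<kappa> a" "F \<in> \<Delta>"
  shows "color_vec \<kappa> F \<le> a"
proof -
  have sc: "finite \<Delta>" "\<forall>F\<in>\<Delta>. finite F"
    using assms by (auto simp: balanced_def simplicial_complex_def)
  obtain G where G: "G \<in> \<Delta>" "F \<subseteq> G" "\<forall>H\<in>\<Delta>. G \<subseteq> H \<longrightarrow> H = G"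
    using finite_has_maximal2[OF sc(1) assms(2)] by metis
  then have "card {v \<in> G. \<kappa> v = i} = a $ i" for i
    using assms(1) by (auto simp: balanced_def maximal_face_def)
  moreover have "card {v \<in> F. \<kappa> v = i} \<le> card {v \<in> G. \<kappa> v = i}" for i
    using G sc by (intro card_mono) auto
  ultimately show ?thesis
    by (simp add: color_vec_def less_eq_vec_def)
qed

lemma keys_mult_le:
  fixes p q :: "'m::finite mpoly_int"
  assumes "Poly_Mapping.keys p \<subseteq> {..c}" "Poly_Mapping.keys q \<subseteq> {..d}"
  shows "Poly_Mapping.keys (p * q) \<subseteq> {..c + d}"
  using assms keys_mult[of p q] by (fastforce simp: less_eq_vec_def intro: add_mono)

lemma keys_prod_power_le:
  fixes p :: "'m::finite \<Rightarrow> 'm mpoly_int"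
  assumes "\<And>i. Poly_Mapping.keys (p i) \<subseteq> {..axis i 1}"
  shows "Poly_Mapping.keys (\<Prod>i\<in>UNIV. p i ^ (c $ i)) \<subseteq> {..c}"
proof -
  have pow: "Poly_Mapping.keys (p i ^ n) \<subseteq> {..axis i n}" for i n
  proof (induction n)
    case (Suc n)
    have "axis i 1 + axis i n = axis i (Suc n)"
      by (simp add: vec_eq_iff axis_def)
    then show ?case using keys_mult_le[OF assms[of i] Suc] by simp
  qed (auto simp: less_eq_vec_def)
  have "Poly_Mapping.keys (\<Prod>i\<in>I. p i ^ (c $ i)) \<subseteq> {..\<Sum>i\<in>I. axis i (c $ i)}" if "finite I" for I
    using that
  proof (induction I)
    case (insert i I)
    then show ?case using keys_mult_le[OF pow] by simp
  qed auto
  from this[of UNIV] have "Poly_Mapping.keys (\<Prod>i\<in>UNIV. p i ^ (c $ i)) \<subseteq> {..\<Sum>i\<in>UNIV. axis i (c $ i)}"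
    by simp
  moreover have "(\<Sum>i\<in>UNIV. axis i (c $ i)) = c"
    by (simp add: vec_eq_iff axis_def if_distrib cong: if_cong)
  ultimately show ?thesis by simp
qed

lemma prod_X_power:
  fixes c :: "nat ^ 'm"
  shows "(\<Prod>i\<in>UNIV. X i ^ (c $ i)) = Poly_Mapping.single c 1"
proof -
  have pow: "X i ^ n = Poly_Mapping.single (axis i n) 1" for i :: "'m" and n
  proof (induction n)
    case (Suc n)
    have "axis i (Suc 0) + axis i n = axis i (Suc n)"
      by (simp add: vec_eq_iff axis_def)
    with Suc show ?case by (simp add: X_def mult_single)
  next
    case 0
    have "axis i 0 = (0 :: nat ^ 'm)"
      by (simp add: vec_eq_iff axis_def)
    then show ?case by (simp only: power_0 single_one)
  qed
  have "(\<Prod>i\<in>I. X i ^ (c $ i)) = Poly_Mapping.single (\<Sum>i\<in>I. axis i (c $ i)) 1"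
    if "finite I" for I using that
    by (induction I) (auto simp: pow mult_single)
  from this[of UNIV] have "(\<Prod>i\<in>UNIV. X i ^ (c $ i)) = Poly_Mapping.single (\<Sum>i\<in>UNIV. axis i (c $ i)) 1"
    by simp
  moreover have "(\<Sum>i\<in>UNIV. axis i (c $ i)) = c"
    by (simp add: vec_eq_iff axis_def if_distrib cong: if_cong)
  ultimately show ?thesis by simp
qed

lemma keys_flag_h_poly:
  fixes a :: "nat ^ 'm"
  assumes "balanced \<Delta> \<kappa> a"
  shows "Poly_Mapping.keys (flag_h_poly \<Delta> \<kappa> a) \<subseteq> {..a}"
proof -
  have X: "Poly_Mapping.keys (X i) \<subseteq> {..axis i 1}" for i :: 'm
    by (simp add: X_def)
  have X1: "Poly_Mapping.keys (1 - X i) \<subseteq> {..axis i 1}" for i :: 'm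
    using keys_diff[of 1 "X i"] X[of i] by (fastforce simp: less_eq_vec_def)
  have "Poly_Mapping.keys ((\<Prod>i\<in>UNIV. X i ^ (color_vec \<kappa> F $ i)) *
              (\<Prod>i\<in>UNIV. (1 - X i) ^ ((a - color_vec \<kappa> F) $ i))) \<subseteq> {..a}" if "F \<in> \<Delta>" for F
  proof -
    have "color_vec \<kappa> F + (a - color_vec \<kappa> F) = a"
      using color_vec_le[OF assms that] by (simp add: vec_eq_iff less_eq_vec_def)
    with keys_mult_le[OF keys_prod_power_le[of X "color_vec \<kappa> F", OF X]
        keys_prod_power_le[of "\<lambda>i. 1 - X i" "a - color_vec \<kappa> F", OF X1]]
    show ?thesis by simp
  qed
  then show ?thesis
    unfolding flag_h_poly_def by (intro order_trans[OF keys_sum]) blast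
qed

lemma finite_atMost_vec: "finite {..a :: nat ^ 'm}"
proof -
  have "inj_on vec_nth {..a}" by (auto simp: inj_on_def vec_eq_iff)
  moreover have "vec_nth ` {..a} \<subseteq> PiE UNIV (\<lambda>i. {..a $ i})"
    by (auto simp: less_eq_vec_def)
  moreover have "finite (PiE UNIV (\<lambda>i. {..a $ i}))"
    by (intro finite_PiE) auto
  ultimately show ?thesis by (meson finite_imageD finite_subset)
qed

lemma flag_h_identity:
  fixes a :: "nat ^ 'm"
  assumes "balanced \<Delta> \<kappa> a"
  shows "(\<Sum>b\<in>{..a}. of_int (flag_h \<Delta> \<kappa> a b) * (\<Prod>i\<in>UNIV. X i ^ (b $ i))) =
         (\<Sum>F\<in>\<Delta>. (\<Prod>i\<in>UNIV. X i ^ (color_vec \<kappa> F $ i)) *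
                  (\<Prod>i\<in>UNIV. (1 - X i) ^ ((a - color_vec \<kappa> F) $ i)))"
proof -
  have "of_int k * (\<Prod>i\<in>UNIV. X i ^ (b $ i)) = Poly_Mapping.single b k" for k and b :: "nat ^ 'm"
    by (simp add: prod_X_power mult_single flip: single_of_int)
  moreover have "(\<Sum>b\<in>{..a}. Poly_Mapping.single b (flag_h \<Delta> \<kappa> a b)) = flag_h_poly \<Delta> \<kappa> a"
  proof (rule poly_mapping_eqI)
    fix c
    show "Poly_Mapping.lookup (\<Sum>b\<in>{..a}. Poly_Mapping.single b (flag_h \<Delta> \<kappa> a b)) c =
          Poly_Mapping.lookup (flag_h_poly \<Delta> \<kappa> a) c"
      using keys_flag_h_poly[OF assms]
      by (auto simp: lookup_sum lookup_single when_def finite_atMost_vec flag_h_def in_keys_iff)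
  qed
  ultimately show ?thesis by (simp add: flag_h_poly_def)
qed

end

theory Submission
  imports Defs
begin

text \<open>
  Write \<open>c(F)\<close> for the color vector of a face and \<open>C\<close> for the binomial coefficient of vectors.
  Reading off the coefficient of the monomial with exponent \<open>b\<close> in the defining polynomial shows
  that \<open>h(b)\<close> is the sum of \<open>(-1)^(|b| + |F|) C(a - c(F), a - b)\<close> over all faces \<open>F\<close>
  (\<open>flag_h_eq_sum\<close>); the terms with \<open>\<not> c(F) \<le> b\<close> vanish.

  The error of a face is a difference of two terms. The subtracted sign \<open>(-1)^(d - 1 - |F|)\<close>
  contributes exactly this sum, that is, \<open>h(b)\<close>. The Euler characteristic of the link of \<open>F\<close> is a
  signed sum over the faces \<open>H\<close> containing \<open>F\<close> (\<open>reduced_euler_link\<close>). Exchanging the two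
  summations leaves, for each face \<open>H\<close>, the alternating sum of \<open>C(a - c(F), a - b)\<close> over the
  subsets \<open>F\<close> of \<open>H\<close>, all of which are faces. Each vertex of \<open>H\<close> takes one finite difference of
  the binomial in the direction of its color, so by Pascal's rule this sum is \<open>C(a - c(H), b)\<close>
  (\<open>alternating_sum_vbinom_subsets\<close>). That is the binomial in the formula for \<open>h(a - b)\<close>, and the
  signs turn the contribution into \<open>- h(a - b)\<close>.
\<close>

section \<open>Vectors and their binomial coefficients\<close>

lemma vsize_diff:
  assumes "b \<le> a"
  shows "vsize (a - b) = vsize a - vsize b"
  using assms unfolding vsize_def less_eq_vec_def
  by (simp add: sum_subtractf_nat)

lemma vsize_mono: "b \<le> a \<Longrightarrow> vsize b \<le> vsize a"
  unfolding vsize_def less_eq_vec_def by (intro sum_mono) auto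

lemma vbinom_eq_0:
  assumes "\<not> k \<le> n"
  shows "vbinom n k = 0"
proof -
  obtain i where "n $ i < k $ i"
    using assms by (auto simp: less_eq_vec_def not_le)
  then show ?thesis
    unfolding vbinom_def by (intro prod_zero) (auto intro!: bexI[of _ i])
qed

lemma vbinom_symmetric: "k \<le> n \<Longrightarrow> vbinom n (n - k) = vbinom n k"
  unfolding vbinom_def less_eq_vec_def
  by (intro prod.cong) (auto simp: binomial_symmetric[symmetric])

lemma vbinom_remove:
  "vbinom n k = (n $ i choose k $ i) * (\<Prod>j\<in>UNIV - {i}. n $ j choose k $ j)"
  unfolding vbinom_def by (subst prod.remove[of _ i]) auto

lemma vbinom_Pascal:
  "vbinom (n + axis i 1) (k + axis i 1) = vbinom n k + vbinom n (k + axis i 1)"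
proof -
  have "(\<Prod>j\<in>UNIV - {i}. (n + axis i 1) $ j choose (k + axis i 1) $ j) =
        (\<Prod>j\<in>UNIV - {i}. n $ j choose k $ j)"
    "(\<Prod>j\<in>UNIV - {i}. n $ j choose (k + axis i 1) $ j) =
        (\<Prod>j\<in>UNIV - {i}. n $ j choose k $ j)"
    by (auto intro!: prod.cong simp: axis_def)
  then show ?thesis
    unfolding vbinom_remove[of _ _ i] by (simp add: distrib_right)
qed

lemma vbinom_add_axis:
  assumes "k $ i = 0"
  shows "vbinom (n + axis i 1) k = vbinom n k"
proof -
  have "(\<Prod>j\<in>UNIV - {i}. (n + axis i 1) $ j choose k $ j) =
        (\<Prod>j\<in>UNIV - {i}. n $ j choose k $ j)"
    by (auto intro!: prod.cong simp: axis_def)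
  then show ?thesis
    unfolding vbinom_remove[of _ _ i] by (simp add: assms)
qed

section \<open>Color vectors\<close>

lemma color_vec_insert:
  assumes "finite F" "v \<notin> F"
  shows "color_vec \<kappa> (insert v F) = color_vec \<kappa> F + axis (\<kappa> v) 1"
proof -
  have "{w \<in> insert v F. \<kappa> w = i} =
        (if \<kappa> v = i then insert v {w \<in> F. \<kappa> w = i} else {w \<in> F. \<kappa> w = i})" for i
    by auto
  then show ?thesis
    using assms by (simp add: vec_eq_iff color_vec_def axis_def)
qed

lemma color_vec_mono: "finite H \<Longrightarrow> F \<subseteq> H \<Longrightarrow> color_vec \<kappa> F \<le> color_vec \<kappa> H"
  unfolding color_vec_def less_eq_vec_def by (auto intro!: card_mono)

lemma vsize_color_vec:
  fixes \<kappa> :: "'v \<Rightarrow> 'm::finite"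
  assumes "finite F"
  shows "vsize (color_vec \<kappa> F) = card F"
  using assms
proof (induction F)
  case empty
  show ?case by (simp add: vsize_def color_vec_def)
next
  case (insert v F)
  then show ?case
    by (simp add: color_vec_insert vsize_def sum.distrib axis_def)
qed

lemma complex_dim_balanced:
  assumes "balanced \<Delta> \<kappa> a"
  shows "complex_dim \<Delta> = int (vsize a) - 1"
proof -
  have sc: "finite \<Delta>" "\<And>F. F \<in> \<Delta> \<Longrightarrow> finite F" "{} \<in> \<Delta>"
    using assms by (auto simp: balanced_def simplicial_complex_def)
  obtain G where G: "G \<in> \<Delta>" "\<forall>H\<in>\<Delta>. G \<subseteq> H \<longrightarrow> H = G"
    using finite_has_maximal2[OF sc(1) sc(3)] by metis
  then have "color_vec \<kappa> G = a"
    using assms by (auto simp: balanced_def maximal_face_def vec_eq_iff color_vec_def)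
  then have "card G = vsize a"
    using vsize_color_vec[of G \<kappa>] sc(2)[OF G(1)] by simp
  moreover have "card F \<le> vsize a" if "F \<in> \<Delta>" for F
    using vsize_mono[OF color_vec_le[OF assms that]] vsize_color_vec[OF sc(2)[OF that], of \<kappa>]
    by simp
  ultimately show ?thesis
    unfolding complex_dim_def using sc G(1) by (intro Max_eqI) (force)+
qed

section \<open>Flag h-numbers as alternating sums over faces\<close>

lemma prod_one_minus_X_power:
  fixes n :: "nat ^ 'm"
  shows "(\<Prod>i\<in>UNIV. (1 - X i) ^ (n $ i)) =
    (\<Sum>k\<in>{..n}. Poly_Mapping.single k ((-1) ^ vsize k * int (vbinom n k)))"
proof -
  have binomial: "(1 - X i) ^ l = (\<Sum>j\<le>l. of_int ((-1) ^ j * int (l choose j)) * X i ^ j)"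
    for i :: 'm and l
    using binomial_ring[of "- X i" 1 l] by (simp add: power_minus[of "X i"] ac_simps)
  have "(\<Prod>i\<in>UNIV. (1 - X i) ^ (n $ i)) =
      (\<Sum>g\<in>PiE UNIV (\<lambda>i. {..n $ i}).
        \<Prod>i\<in>UNIV. of_int ((-1) ^ g i * int (n $ i choose g i)) * X i ^ g i)"
    unfolding binomial by (rule prod_sum_PiE) auto
  also have "\<dots> = (\<Sum>k\<in>{..n}.
        \<Prod>i\<in>UNIV. of_int ((-1) ^ (k $ i) * int (n $ i choose k $ i)) * X i ^ (k $ i))"
    by (rule sum.reindex_bij_witness[of _ vec_nth vec_lambda])
      (auto simp: less_eq_vec_def PiE_iff)
  also have "\<dots> = (\<Sum>k\<in>{..n}. Poly_Mapping.single k ((-1) ^ vsize k * int (vbinom n k)))"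
  proof (rule sum.cong[OF refl])
    fix k :: "nat ^ 'm"
    have "(\<Prod>i\<in>UNIV. of_int ((-1) ^ (k $ i) * int (n $ i choose k $ i)) * X i ^ (k $ i)) =
        of_int (\<Prod>i\<in>UNIV. (-1) ^ (k $ i) * int (n $ i choose k $ i)) * Poly_Mapping.single k 1"
      by (simp only: prod.distrib prod_X_power of_int_prod of_int_mult)
    also have "(\<Prod>i\<in>UNIV. (-1) ^ (k $ i) * int (n $ i choose k $ i)) =
        (-1) ^ vsize k * int (vbinom n k)"
      unfolding prod.distrib by (simp add: vsize_def vbinom_def power_sum)
    finally show "(\<Prod>i\<in>UNIV. of_int ((-1) ^ (k $ i) * int (n $ i choose k $ i)) * X i ^ (k $ i)) =
        Poly_Mapping.single k ((-1) ^ vsize k * int (vbinom n k))"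
      by (simp only: single_of_int[symmetric] mult_single) simp
  qed
  finally show ?thesis .
qed

text \<open>
  The coefficient is \<open>\<plusminus>binom(a - c, b - c)\<close>; written with lower index \<open>a - b\<close> it needs no
  case distinction on \<open>c \<le> b\<close>, which allows sums over all faces below.
\<close>

lemma lookup_face_monomial:
  fixes a b c :: "nat ^ 'm"
  assumes "c \<le> a" "b \<le> a"
  shows "Poly_Mapping.lookup
      ((\<Prod>i\<in>UNIV. X i ^ (c $ i)) * (\<Prod>i\<in>UNIV. (1 - X i) ^ ((a - c) $ i))) b =
    (-1) ^ (vsize b + vsize c) * int (vbinom (a - c) (a - b))"
proof -
  let ?t = "\<lambda>k. (-1) ^ vsize k * int (vbinom (a - c) k)"
  have "(\<Prod>i\<in>UNIV. X i ^ (c $ i)) * (\<Prod>i\<in>UNIV. (1 - X i) ^ ((a - c) $ i)) =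
      (\<Sum>k\<in>{..a - c}. Poly_Mapping.single (c + k) (?t k))"
    unfolding prod_X_power prod_one_minus_X_power sum_distrib_left mult_single by simp
  then have L: "Poly_Mapping.lookup
      ((\<Prod>i\<in>UNIV. X i ^ (c $ i)) * (\<Prod>i\<in>UNIV. (1 - X i) ^ ((a - c) $ i))) b =
      (\<Sum>k\<in>{..a - c}. if c + k = b then ?t k else 0)"
    by (simp add: lookup_sum lookup_single when_def)
  show ?thesis
  proof (cases "c \<le> b")
    case True
    have "(c + k = b) = (k = b - c)" for k
      proof
      assume "k = b - c"
      then show "c + k = b"
        using True by (simp add: vec_eq_iff less_eq_vec_def)
    qed (metis add_diff_cancel_left')
    moreover have "b - c \<le> a - c"
      using assms by (simp add: less_eq_vec_def diff_le_mono)
    ultimately have "(\<Sum>k\<in>{..a - c}. if c + k = b then ?t k else 0) = ?t (b - c)"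
      by (simp add: finite_atMost_vec)
    moreover have "a - c - (b - c) = a - b"
      using True assms by (simp add: vec_eq_iff less_eq_vec_def)
    then have "vbinom (a - c) (b - c) = vbinom (a - c) (a - b)"
      using vbinom_symmetric[OF \<open>b - c \<le> a - c\<close>] by simp
    moreover have "(-1 :: int) ^ vsize (b - c) = (-1) ^ (vsize b + vsize c)"
      using vsize_mono[OF True] by (simp add: vsize_diff[OF True] minus_one_power_iff)
    ultimately show ?thesis using L by simp
  next
    case False
    have "c + k \<noteq> b" for k
      using False by (auto simp: less_eq_vec_def)
    moreover have "\<not> a - b \<le> a - c"
      using False assms by (simp add: less_eq_vec_def) (metis diff_le_mono2 diff_diff_cancel)
    ultimately show ?thesis
      using L by (simp add: vbinom_eq_0)
  qed
qed

lemma flag_h_eq_sum: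
  assumes "balanced \<Delta> \<kappa> a" "b \<le> a"
  shows "flag_h \<Delta> \<kappa> a b =
    (\<Sum>F\<in>\<Delta>. (-1) ^ (vsize b + card F) * int (vbinom (a - color_vec \<kappa> F) (a - b)))"
proof -
  have "\<And>F. F \<in> \<Delta> \<Longrightarrow> finite F"
    using assms by (auto simp: balanced_def simplicial_complex_def)
  then show ?thesis
    unfolding flag_h_def flag_h_poly_def lookup_sum
    by (intro sum.cong)
      (simp_all only: lookup_face_monomial[OF color_vec_le[OF assms(1)] assms(2)] vsize_color_vec)
qed

section \<open>The contribution of the links\<close>

text \<open>
  Adding a vertex to \<open>H\<close> subtracts from the sum for \<open>k + b\<close> the same sum with \<open>k + b\<close> lowered
  by one in the color of the vertex; Pascal's rule then gives the right-hand side. The induction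
  keeps \<open>k\<close> fixed and lowers \<open>b\<close>, which is possible only if \<open>b\<close> has a positive entry there;
  otherwise all binomials subtracted vanish.
\<close>

lemma alternating_sum_vbinom_subsets:
  fixes \<kappa> :: "'v \<Rightarrow> 'm::finite"
  assumes "finite H" "color_vec \<kappa> H \<le> k + b"
  shows "(\<Sum>F\<in>Pow H. (-1) ^ card F * int (vbinom (k + b - color_vec \<kappa> F) k)) =
         int (vbinom (k + b - color_vec \<kappa> H) b)"
  using assms
proof (induction H arbitrary: b rule: finite_induct)
  case empty
  have "color_vec \<kappa> {} = 0" by (simp add: color_vec_def vec_eq_iff)
  moreover have "k + b - b = k" "b \<le> k + b" by (auto simp: vec_eq_iff less_eq_vec_def)
  ultimately show ?case using vbinom_symmetric[of b "k + b"] by simp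
next
  case (insert v H)
  define e :: "nat ^ 'm" where "e = axis (\<kappa> v) 1"
  let ?c = "color_vec \<kappa>"
  have c: "?c (insert v F) = ?c F + e" if "F \<subseteq> H" for F
    unfolding e_def by (rule color_vec_insert) (use that insert.hyps finite_subset in auto)
  have le: "?c H + e \<le> k + b"
    using insert.prems c[of H] by simp
  then have leH: "?c H \<le> k + b"
    by (auto simp: less_eq_vec_def intro: add_leD1)
  have inj: "inj_on (insert v) (Pow H)"
    using insert.hyps by (auto simp: inj_on_def)
  have disj: "Pow H \<inter> insert v ` Pow H = {}"
    using insert.hyps by auto
  have card: "card (insert v F) = Suc (card F)" if "F \<subseteq> H" for F
    using that insert.hyps finite_subset by (subst card_insert_disjoint) auto
  have "(\<Sum>F\<in>Pow (insert v H). (-1) ^ card F * int (vbinom (k + b - ?c F) k)) =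
      (\<Sum>F\<in>Pow H. (-1) ^ card F * int (vbinom (k + b - ?c F) k)) +
      (\<Sum>F\<in>Pow H. (-1) ^ card (insert v F) * int (vbinom (k + b - ?c (insert v F)) k))"
    unfolding Pow_insert using insert.hyps disj
    by (simp add: sum.union_disjoint sum.reindex[OF inj])
  also have "(\<Sum>F\<in>Pow H. (-1) ^ card (insert v F) * int (vbinom (k + b - ?c (insert v F)) k)) =
      - (\<Sum>F\<in>Pow H. (-1) ^ card F * int (vbinom (k + b - (?c F + e)) k))"
    by (simp add: sum_negf[symmetric] c card)
  also have "(\<Sum>F\<in>Pow H. (-1) ^ card F * int (vbinom (k + b - ?c F) k)) =
      int (vbinom (k + b - ?c H) b)"
    by (rule insert.IH[OF leH])
  also have "int (vbinom (k + b - ?c H) b) +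
      - (\<Sum>F\<in>Pow H. (-1) ^ card F * int (vbinom (k + b - (?c F + e)) k)) =
      int (vbinom (k + b - (?c H + e)) b)"
  proof (cases "b $ \<kappa> v = 0")
    case True
    \<comment> \<open>The upper index is below \<open>k\<close> in the color of \<open>v\<close>, since \<open>b\<close> adds nothing there.\<close>
    have "\<not> k \<le> k + b - (?c F + e)" if "F \<subseteq> H" for F
    proof
      assume "k \<le> k + b - (?c F + e)"
      moreover have "?c F + e \<le> k + b"
        using le color_vec_mono[OF insert.hyps(1) that, of \<kappa>]
        by (auto simp: less_eq_vec_def intro: order_trans[OF add_right_mono])
      ultimately have "k $ \<kappa> v \<le> k $ \<kappa> v - (?c F $ \<kappa> v + 1)"
          "?c F $ \<kappa> v + 1 \<le> k $ \<kappa> v"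
        using True unfolding less_eq_vec_def
        by (auto simp: e_def dest!: spec[of _ "\<kappa> v"])
      then show False by simp
    qed
    then have "(\<Sum>F\<in>Pow H. (-1) ^ card F * int (vbinom (k + b - (?c F + e)) k)) = 0"
      by (simp add: vbinom_eq_0)
    moreover have "k + b - ?c H = k + b - (?c H + e) + e"
      using le by (auto simp: vec_eq_iff less_eq_vec_def)
    ultimately show ?thesis
      using vbinom_add_axis[OF True] by (simp add: e_def)
  next
    case False
    define b' where "b' = b - e"
    have b: "b = b' + e"
      using False by (auto simp: b'_def e_def vec_eq_iff axis_def)
    have shift: "k + b - (u + e) = k + b' - u" for u
      by (simp add: b vec_eq_iff)
    have "?c H \<le> k + b'"
      using le by (auto simp: b less_eq_vec_def)
    then have "(\<Sum>F\<in>Pow H. (-1) ^ card F * int (vbinom (k + b - (?c F + e)) k)) =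
        int (vbinom (k + b' - ?c H) b')"
      unfolding shift by (rule insert.IH)
    moreover have "k + b - ?c H = k + b' - ?c H + e"
      using \<open>?c H \<le> k + b'\<close> by (auto simp: b vec_eq_iff less_eq_vec_def)
    ultimately show ?thesis
      unfolding shift using vbinom_Pascal[of "k + b' - ?c H" "\<kappa> v" b'] by (simp add: b e_def)
  qed
  finally show ?case using c[of H] by simp
qed

lemma neg_one_power_diff: "neg_one_power (int m - int n - 1) = - ((-1) ^ (m + n))"
  by (simp add: neg_one_power_def minus_one_power_iff)

text \<open>
  A face of the link is determined by its union with \<open>F\<close>, which can be any face containing \<open>F\<close>.
\<close>

lemma reduced_euler_link:
  assumes "simplicial_complex \<Delta>" "F \<in> \<Delta>"
  shows "reduced_euler (link \<Delta> F) = (\<Sum>H\<in>{H \<in> \<Delta>. F \<subseteq> H}. - ((-1) ^ (card H + card F)))"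
  unfolding reduced_euler_def
proof (rule sum.reindex_bij_witness[of _ "\<lambda>H. H - F" "\<lambda>G. G \<union> F"])
  fix G assume "G \<in> link \<Delta> F"
  then have G: "finite G" "finite F" "G \<inter> F = {}"
    using assms by (auto simp: link_def simplicial_complex_def)
  then show "- ((-1) ^ (card (G \<union> F) + card F)) = neg_one_power (int (card G) - 1)"
    by (simp add: card_Un_disjoint neg_one_power_diff[of _ 0, simplified] power_add minus_one_power_iff)
qed (use assms in \<open>auto simp: link_def simplicial_complex_def Un_absorb2\<close>)

section \<open>The reflection formula\<close>

theorem theorem6p4:
  fixes \<Delta> :: "'v set set" and \<kappa> :: "'v \<Rightarrow> 'm::finite" and a b :: "nat ^ 'm"
  assumes "balanced \<Delta> \<kappa> a" and "b \<le> a"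
  shows "flag_h \<Delta> \<kappa> a b - flag_h \<Delta> \<kappa> a (a - b) =
         (-1) ^ (vsize a - vsize b) *
         (\<Sum>F\<in>{F \<in> \<Delta>. color_vec \<kappa> F \<le> b}.
            int (vbinom (a - color_vec \<kappa> F) (a - b)) * face_error \<Delta> F)"
proof -
  have sc: "simplicial_complex \<Delta>"
    using assms by (simp add: balanced_def)
  then have fin: "finite \<Delta>" "\<And>F. F \<in> \<Delta> \<Longrightarrow> finite F"
    and sub: "\<And>F G. F \<in> \<Delta> \<Longrightarrow> G \<subseteq> F \<Longrightarrow> G \<in> \<Delta>"
    by (auto simp: simplicial_complex_def)
  have ab: "a - (a - b) = b" "a - b + b = a" "a - b \<le> a"
    using assms(2) by (auto simp: vec_eq_iff less_eq_vec_def)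
  let ?w = "\<lambda>F. int (vbinom (a - color_vec \<kappa> F) (a - b))"
  let ?s = "(-1 :: int) ^ (vsize a - vsize b)"
  have sb: "(-1 :: int) ^ (vsize b + n) = ?s * (-1) ^ (vsize a + n)" for n
    using vsize_mono[OF assms(2)] by (simp add: minus_one_power_iff)

  have "(\<Sum>F\<in>{F \<in> \<Delta>. color_vec \<kappa> F \<le> b}. ?w F * face_error \<Delta> F) =
      (\<Sum>F\<in>\<Delta>. ?w F * face_error \<Delta> F)"
  proof (rule sum.mono_neutral_left)
    show "\<forall>F\<in>\<Delta> - {F \<in> \<Delta>. color_vec \<kappa> F \<le> b}. ?w F * face_error \<Delta> F = 0"
    proof
      fix F assume F: "F \<in> \<Delta> - {F \<in> \<Delta>. color_vec \<kappa> F \<le> b}"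
      then have "\<not> a - b \<le> a - color_vec \<kappa> F"
        using assms(2) color_vec_le[OF assms(1), of F]
        by (simp add: less_eq_vec_def) (metis diff_le_mono2 diff_diff_cancel)
      then show "?w F * face_error \<Delta> F = 0"
        by (simp add: vbinom_eq_0)
    qed
  qed (use fin in auto)
  also have "\<dots> = (\<Sum>F\<in>\<Delta>. ?w F * reduced_euler (link \<Delta> F)) +
      (\<Sum>F\<in>\<Delta>. (-1) ^ (vsize a + card F) * ?w F)"
  proof -
    have "neg_one_power (complex_dim \<Delta> - int (card F)) = - ((-1) ^ (vsize a + card F))"
      for F :: "'v set"
      using neg_one_power_diff[of "vsize a" "card F"]
      by (simp add: complex_dim_balanced[OF assms(1)] algebra_simps)
    then show ?thesis
      by (simp add: face_error_def sum.distrib[symmetric] algebra_simps)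
  qed
  also have "?s * \<dots> = ?s * (\<Sum>F\<in>\<Delta>. ?w F * reduced_euler (link \<Delta> F)) + flag_h \<Delta> \<kappa> a b"
    unfolding flag_h_eq_sum[OF assms] sb distrib_left sum_distrib_left by (simp add: ac_simps)
  also have "(\<Sum>F\<in>\<Delta>. ?w F * reduced_euler (link \<Delta> F)) =
      (\<Sum>F\<in>\<Delta>. \<Sum>H\<in>{H \<in> \<Delta>. F \<subseteq> H}. - ((-1) ^ card H * ((-1) ^ card F * ?w F)))"
    by (intro sum.cong) (simp_all add: reduced_euler_link[OF sc] sum_distrib_left power_add ac_simps)
  also have "\<dots> = (\<Sum>H\<in>\<Delta>. \<Sum>F\<in>{F \<in> \<Delta>. F \<subseteq> H}. - ((-1) ^ card H * ((-1) ^ card F * ?w F)))"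
    by (rule sum.swap_restrict) (use fin in auto)
  also have "\<dots> = (\<Sum>H\<in>\<Delta>. - ((-1) ^ card H * int (vbinom (a - color_vec \<kappa> H) b)))"
  proof (rule sum.cong[OF refl])
    fix H assume H: "H \<in> \<Delta>"
    have "{F \<in> \<Delta>. F \<subseteq> H} = Pow H"
      using sub[OF H] by auto
    moreover have "(\<Sum>F\<in>Pow H. (-1) ^ card F * ?w F) = int (vbinom (a - color_vec \<kappa> H) b)"
      using alternating_sum_vbinom_subsets[OF fin(2)[OF H], of \<kappa> "a - b" b]
        color_vec_le[OF assms(1) H] by (simp add: ab)
    ultimately show "(\<Sum>F\<in>{F \<in> \<Delta>. F \<subseteq> H}. - ((-1) ^ card H * ((-1) ^ card F * ?w F))) =
        - ((-1) ^ card H * int (vbinom (a - color_vec \<kappa> H) b))"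
      by (simp add: sum_negf sum_distrib_left[symmetric])
  qed
  also have "?s * \<dots> = - flag_h \<Delta> \<kappa> a (a - b)"
    unfolding flag_h_eq_sum[OF assms(1) ab(3)] ab vsize_diff[OF assms(2)]
    by (simp add: sum_negf sum_distrib_left power_add ac_simps)
  finally show ?thesis by simp
qed

end
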